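(* Let $n\ge 2$, let $\mathfrak{t}^*$ be the real vector space with basis $x_1,\dots,x_{n+1}$, and let $W=S_{n+1}$ act on $\mathfrak{t}^*$ (and on $\mathbb{S}(\mathfrak{t}^* )=\mathbb{R}[x_1,\dots,x_{n+1}]$) by $w\cdot x_i=x_{w(i)}$. Let $H_\alpha^*(W)$ be the ring of maps $f\colon S_{n+1}\to\mathbb{R}[x_1,\dots,x_{n+1}]$ such that $f(u\circ(i,j))-f(u)$ is divisible by $x_{u(i)}-x_{u(j)}$ for all $u\in S_{n+1}$ and $1\le i<j\le n+1$. For a multi-index $I=[i_1,\dots,i_n]$ of non-negative integers let $c_I\colon S_{n+1}\to\mathbb{R}[x_1,\dots,x_{n+1}]$, $c_I(u)=x_{u(1)}^{i_1}x_{u(2)}^{i_2}\cdots x_{u(n)}^{i_n}$, and let $$\mathcal{A}_n=\{[i_1,\dots,i_n]:0\le i_k\le n+1-k\ \text{for }k=1,\dots,n\}.$$ Then $\{c_I: I\in\mathcal{A}_n\}$ is a basis of the $\mathbb{R}[x_1,\dots,x_{n+1}]$-module $H_\alpha^*(W)$, consisting of $W$-invariant classes.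
   Context: $(i,j)$ denotes the transposition of $i$ and $j$, and $u\circ(i,j)$ permutes positions of $u$. $W$ acts on $H_\alpha^*(W)$ by $(w\cdot f)(v)=w^{-1}\cdot f(wv)$; a class is $W$-invariant if fixed by all $w$. This is the root system $A_n$ with positive roots $x_i-x_j$, $i<j$. *)

theory Defs
  imports
    Complex_Main
    "HOL-Library.Poly_Mapping"
    "HOL-Combinatorics.Permutations"
    "HOL-Algebra.Divisibility"
    "HOL-Algebra.Module"
    "Jordan_Normal_Form.Missing_VectorSpace"
begin

text \<open>
  Polynomials over the reals in variables indexed by the natural numbers: finitely supported
  maps from monomials to coefficients, a monomial being a finitely supported exponent map.
\<close>

type_synonym rpoly = "(nat \<Rightarrow>\<^sub>0 nat) \<Rightarrow>\<^sub>0 real"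

definition X :: "nat \<Rightarrow> rpoly" where
  "X i = Poly_Mapping.single (Poly_Mapping.single i 1) 1"

text \<open>The ring \<open>\<real>[x\<^sub>1, \<dots>, x\<^sub>m]\<close>; no other variable may occur.\<close>

definition poly_ring :: "nat \<Rightarrow> rpoly ring" where
  "poly_ring m =
    \<lparr>carrier = {p. \<forall>e \<in> Poly_Mapping.keys p. Poly_Mapping.keys e \<subseteq> {1..m}},
     mult = (*), one = 1, zero = 0, add = (+)\<rparr>"

definition Sym :: "nat \<Rightarrow> (nat \<Rightarrow> nat) set" where
  "Sym m = {w. w permutes {1..m}}"

text \<open>The substitution \<open>x\<^sub>i \<mapsto> x\<^bsub>w(i)\<^esub>\<close>, i.e. the algebra automorphism \<open>p \<mapsto> w \<cdot> p\<close>.\<close>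

definition perm_act :: "(nat \<Rightarrow> nat) \<Rightarrow> rpoly \<Rightarrow> rpoly" where
  "perm_act w p =
    (\<Sum>e \<in> Poly_Mapping.keys p.
      Poly_Mapping.single 0 (Poly_Mapping.lookup p e) *
      (\<Prod>i \<in> Poly_Mapping.keys e. X (w i) ^ Poly_Mapping.lookup e i))"

text \<open>
  The algebra \<open>H\<^sub>\<alpha>\<^sup>*(W)\<close> for \<open>W = S\<^bsub>n+1\<^esub>\<close>, with pointwise operations. Maps on \<open>W\<close> are
  represented by functions that are \<open>undefined\<close> outside \<open>W\<close>.
\<close>

definition Halpha :: "nat \<Rightarrow> (rpoly, (nat \<Rightarrow> nat) \<Rightarrow> rpoly) module" where
  "Halpha n =
    \<lparr>carrier = {f \<in> Sym (n + 1) \<rightarrow>\<^sub>E carrier (poly_ring (n + 1)).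
       \<forall>u \<in> Sym (n + 1). \<forall>i j. 1 \<le> i \<and> i < j \<and> j \<le> n + 1 \<longrightarrow>
         (X (u i) - X (u j)) divides\<^bsub>poly_ring (n + 1)\<^esub>
           (f (u \<circ> Transposition.transpose i j) - f u)},
     mult = (\<lambda>f g. \<lambda>u \<in> Sym (n + 1). f u * g u),
     one = (\<lambda>u \<in> Sym (n + 1). 1),
     zero = (\<lambda>u \<in> Sym (n + 1). 0),
     add = (\<lambda>f g. \<lambda>u \<in> Sym (n + 1). f u + g u),
     smult = (\<lambda>p f. \<lambda>u \<in> Sym (n + 1). p * f u)\<rparr>"

definition class_act ::
    "nat \<Rightarrow> (nat \<Rightarrow> nat) \<Rightarrow> ((nat \<Rightarrow> nat) \<Rightarrow> rpoly) \<Rightarrow> ((nat \<Rightarrow> nat) \<Rightarrow> rpoly)" where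
  "class_act n w f = (\<lambda>v \<in> Sym (n + 1). perm_act (Hilbert_Choice.inv w) (f (w \<circ> v)))"

definition W_invariant :: "nat \<Rightarrow> ((nat \<Rightarrow> nat) \<Rightarrow> rpoly) \<Rightarrow> bool" where
  "W_invariant n f \<longleftrightarrow> (\<forall>w \<in> Sym (n + 1). class_act n w f = f)"

text \<open>The multi-index \<open>[i\<^sub>1, \<dots>, i\<^sub>n]\<close> is a list, so that \<open>i\<^sub>k\<close> is \<open>I ! (k - 1)\<close>.\<close>

definition c_class :: "nat \<Rightarrow> nat list \<Rightarrow> (nat \<Rightarrow> nat) \<Rightarrow> rpoly" where
  "c_class n I = (\<lambda>u \<in> Sym (n + 1). \<Prod>k = 1..n. X (u k) ^ (I ! (k - 1)))"

definition A_set :: "nat \<Rightarrow> nat list set" where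
  "A_set n = {I. length I = n \<and> (\<forall>k \<in> {1..n}. I ! (k - 1) \<le> n + 1 - k)}"

definition is_module_basis ::
    "('a, 'r) ring_scheme \<Rightarrow> ('a, 'b, 'm) module_scheme \<Rightarrow> 'b set \<Rightarrow> bool" where
  "is_module_basis R M B \<longleftrightarrow>
    Module.module R M \<and> B \<subseteq> carrier M \<and>
    \<not> LinearCombinations.module.lin_dep R M B \<and>
    LinearCombinations.module.span R M B = carrier M"

lemma poly_ring_simps [simp]:
  "mult (poly_ring m) = (*)" "one (poly_ring m) = 1"
  "zero (poly_ring m) = 0" "add (poly_ring m) = (+)"
  by (simp_all add: poly_ring_def)

lemma Halpha_simps [simp]:
  "mult (Halpha n) = (\<lambda>f g. \<lambda>u \<in> Sym (n + 1). f u * g u)"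
  "one (Halpha n) = (\<lambda>u \<in> Sym (n + 1). 1)"
  "zero (Halpha n) = (\<lambda>u \<in> Sym (n + 1). 0)"
  "add (Halpha n) = (\<lambda>f g. \<lambda>u \<in> Sym (n + 1). f u + g u)"
  "smult (Halpha n) = (\<lambda>p f. \<lambda>u \<in> Sym (n + 1). p * f u)"
  by (simp_all add: Halpha_def)

lemma poly_ring_closed:
  shows poly_ring_zero: "0 \<in> carrier (poly_ring m)"
    and poly_ring_one: "1 \<in> carrier (poly_ring m)"
    and poly_ring_add: "p \<in> carrier (poly_ring m) \<Longrightarrow> q \<in> carrier (poly_ring m) \<Longrightarrow>
          p + q \<in> carrier (poly_ring m)"
    and poly_ring_mult: "p \<in> carrier (poly_ring m) \<Longrightarrow> q \<in> carrier (poly_ring m) \<Longrightarrow>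
          p * q \<in> carrier (poly_ring m)"
    and poly_ring_uminus: "p \<in> carrier (poly_ring m) \<Longrightarrow> - p \<in> carrier (poly_ring m)"
proof -
  show "0 \<in> carrier (poly_ring m)" "1 \<in> carrier (poly_ring m)"
    by (simp_all add: poly_ring_def)
  show "p + q \<in> carrier (poly_ring m)"
    if "p \<in> carrier (poly_ring m)" "q \<in> carrier (poly_ring m)"
    using that Poly_Mapping.keys_add[of p q] by (auto simp: poly_ring_def)
  show "- p \<in> carrier (poly_ring m)" if "p \<in> carrier (poly_ring m)"
    using that by (simp add: poly_ring_def)
  show "p * q \<in> carrier (poly_ring m)"
    if pq: "p \<in> carrier (poly_ring m)" "q \<in> carrier (poly_ring m)"
  proof -
    have "Poly_Mapping.keys e \<subseteq> {1..m}" if e: "e \<in> Poly_Mapping.keys (p * q)" for e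
    proof -
      obtain a b where ab: "e = a + b" "a \<in> Poly_Mapping.keys p" "b \<in> Poly_Mapping.keys q"
        using keys_mult[of p q] e by blast
      have "Poly_Mapping.keys a \<subseteq> {1..m}" "Poly_Mapping.keys b \<subseteq> {1..m}"
        using pq ab by (simp_all add: poly_ring_def)
      then show ?thesis
        using Poly_Mapping.keys_add[of a b] ab(1) by blast
    qed
    then show ?thesis by (simp add: poly_ring_def)
  qed
qed

lemma cring_poly_ring: "cring (poly_ring m)"
proof (rule cringI)
  show "abelian_group (poly_ring m)"
  proof (rule abelian_groupI)
    show "\<exists>y\<in>carrier (poly_ring m). y \<oplus>\<^bsub>poly_ring m\<^esub> x = \<zero>\<^bsub>poly_ring m\<^esub>"
      if "x \<in> carrier (poly_ring m)" for x
      using that by (intro bexI[of _ "- x"]) (simp_all add: poly_ring_uminus)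
  qed (simp_all add: poly_ring_closed algebra_simps)
  show "Group.comm_monoid (poly_ring m)"
    by (rule comm_monoidI) (simp_all add: poly_ring_closed algebra_simps)
qed (simp_all add: algebra_simps)

text \<open>Divisibility in \<open>\<real>[x\<^sub>1, \<dots>, x\<^sub>m]\<close> is compatible with the operations of \<open>Halpha\<close>.\<close>

lemma
  shows divides_poly_ring_add: "d divides\<^bsub>poly_ring m\<^esub> (a - b) \<Longrightarrow> d divides\<^bsub>poly_ring m\<^esub> (a' - b') \<Longrightarrow>
    d divides\<^bsub>poly_ring m\<^esub> ((a + a') - (b + b'))"
  and divides_poly_ring_mult: "d divides\<^bsub>poly_ring m\<^esub> (a - b) \<Longrightarrow> d divides\<^bsub>poly_ring m\<^esub> (a' - b') \<Longrightarrow>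
    a \<in> carrier (poly_ring m) \<Longrightarrow> b' \<in> carrier (poly_ring m) \<Longrightarrow>
    d divides\<^bsub>poly_ring m\<^esub> (a * a' - b * b')"
  and divides_poly_ring_smult: "d divides\<^bsub>poly_ring m\<^esub> (a - b) \<Longrightarrow> p \<in> carrier (poly_ring m) \<Longrightarrow>
    d divides\<^bsub>poly_ring m\<^esub> (p * a - p * b)"
  and divides_poly_ring_zero: "d divides\<^bsub>poly_ring m\<^esub> 0"
proof -
  show "d divides\<^bsub>poly_ring m\<^esub> ((a + a') - (b + b'))"
    if d1: "d divides\<^bsub>poly_ring m\<^esub> (a - b)" and d2: "d divides\<^bsub>poly_ring m\<^esub> (a' - b')"
  proof -
    obtain c c' where "c \<in> carrier (poly_ring m)" "a - b = d * c"
      "c' \<in> carrier (poly_ring m)" "a' - b' = d * c'"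
      using d1 d2 by (auto simp: factor_def)
    then show ?thesis
      unfolding factor_def by (intro bexI[of _ "c + c'"]) (simp_all add: poly_ring_add algebra_simps)
  qed
  show "d divides\<^bsub>poly_ring m\<^esub> (a * a' - b * b')"
    if d1: "d divides\<^bsub>poly_ring m\<^esub> (a - b)" and d2: "d divides\<^bsub>poly_ring m\<^esub> (a' - b')"
      and cl: "a \<in> carrier (poly_ring m)" "b' \<in> carrier (poly_ring m)"
  proof -
    obtain c c' where c: "c \<in> carrier (poly_ring m)" "a - b = d * c"
      "c' \<in> carrier (poly_ring m)" "a' - b' = d * c'"
      using d1 d2 by (auto simp: factor_def)
    have "a * a' - b * b' = a * (a' - b') + (a - b) * b'"
      by (simp add: algebra_simps)
    also have "\<dots> = d * (a * c' + c * b')"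
      by (simp add: c algebra_simps)
    finally show ?thesis
      unfolding factor_def using c cl
      by (intro bexI[of _ "a * c' + c * b'"]) (simp_all add: poly_ring_add poly_ring_mult)
  qed
  show "d divides\<^bsub>poly_ring m\<^esub> (p * a - p * b)"
    if d1: "d divides\<^bsub>poly_ring m\<^esub> (a - b)" and cl: "p \<in> carrier (poly_ring m)"
  proof -
    obtain c where c: "c \<in> carrier (poly_ring m)" "a - b = d * c"
      using d1 by (auto simp: factor_def)
    have "p * a - p * b = d * (p * c)"
      using c(2) by (metis mult.left_commute right_diff_distrib)
    then show ?thesis
      unfolding factor_def using c cl by (intro bexI[of _ "p * c"]) (simp_all add: poly_ring_mult)
  qed
  show "d divides\<^bsub>poly_ring m\<^esub> 0"
    unfolding factor_def by (intro bexI[of _ 0]) (simp_all add: poly_ring_zero)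
qed

lemma Sym_comp_transpose:
  "u \<in> Sym m \<Longrightarrow> 1 \<le> i \<Longrightarrow> i < j \<Longrightarrow> j \<le> m \<Longrightarrow> u \<circ> Transposition.transpose i j \<in> Sym m"
  by (auto simp: Sym_def intro!: permutes_compose permutes_swap_id)

lemma Halpha_carrierI:
  assumes "\<And>u. u \<in> Sym (n + 1) \<Longrightarrow> f u \<in> carrier (poly_ring (n + 1))"
    and "\<And>u i j. \<lbrakk>u \<in> Sym (n + 1); u \<circ> Transposition.transpose i j \<in> Sym (n + 1);
            1 \<le> i; i < j; j \<le> n + 1\<rbrakk> \<Longrightarrow>
           (X (u i) - X (u j)) divides\<^bsub>poly_ring (n + 1)\<^esub>
             (f (u \<circ> Transposition.transpose i j) - f u)"
  shows "(\<lambda>u \<in> Sym (n + 1). f u) \<in> carrier (Halpha n)"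
  using assms Sym_comp_transpose[of _ "n + 1"] by (auto simp: Halpha_def)

lemma Halpha_carrierD:
  assumes "f \<in> carrier (Halpha n)"
  shows "u \<in> Sym (n + 1) \<Longrightarrow> f u \<in> carrier (poly_ring (n + 1))"
    and "\<lbrakk>u \<in> Sym (n + 1); 1 \<le> i; i < j; j \<le> n + 1\<rbrakk> \<Longrightarrow>
           (X (u i) - X (u j)) divides\<^bsub>poly_ring (n + 1)\<^esub>
             (f (u \<circ> Transposition.transpose i j) - f u)"
    and "f \<in> extensional (Sym (n + 1))"
  using assms by (auto simp: Halpha_def PiE_def)

lemma Halpha_closed:
  shows Halpha_zero: "(\<lambda>u \<in> Sym (n + 1). 0) \<in> carrier (Halpha n)"
    and Halpha_one: "(\<lambda>u \<in> Sym (n + 1). 1) \<in> carrier (Halpha n)"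
    and Halpha_add: "f \<in> carrier (Halpha n) \<Longrightarrow> g \<in> carrier (Halpha n) \<Longrightarrow>
      (\<lambda>u \<in> Sym (n + 1). f u + g u) \<in> carrier (Halpha n)"
    and Halpha_mult: "f \<in> carrier (Halpha n) \<Longrightarrow> g \<in> carrier (Halpha n) \<Longrightarrow>
      (\<lambda>u \<in> Sym (n + 1). f u * g u) \<in> carrier (Halpha n)"
    and Halpha_smult: "p \<in> carrier (poly_ring (n + 1)) \<Longrightarrow> f \<in> carrier (Halpha n) \<Longrightarrow>
      (\<lambda>u \<in> Sym (n + 1). p * f u) \<in> carrier (Halpha n)"
  by (rule Halpha_carrierI;
      simp add: poly_ring_closed divides_poly_ring_zero Halpha_carrierD[simplified]
        divides_poly_ring_add divides_poly_ring_mult divides_poly_ring_smult)+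

lemma algebra_Halpha: "algebra (poly_ring (n + 1)) (Halpha n)"
proof -
  have ext: "(\<lambda>u \<in> Sym (n + 1). f u) = f" if "f \<in> carrier (Halpha n)" for f
    using Halpha_carrierD(3)[OF that] by (rule extensional_restrict)
  have grp: "abelian_group (Halpha n)"
  proof (rule abelian_groupI)
    show "\<exists>g\<in>carrier (Halpha n). g \<oplus>\<^bsub>Halpha n\<^esub> f = \<zero>\<^bsub>Halpha n\<^esub>"
      if f: "f \<in> carrier (Halpha n)" for f
    proof
      show "(\<lambda>u \<in> Sym (n + 1). (- 1) * f u) \<in> carrier (Halpha n)"
        by (intro Halpha_smult f poly_ring_uminus poly_ring_one)
    qed (auto simp: fun_eq_iff)
    show "\<zero>\<^bsub>Halpha n\<^esub> \<oplus>\<^bsub>Halpha n\<^esub> f = f" if f: "f \<in> carrier (Halpha n)" for f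
      using ext[OF f] by (simp cong: restrict_cong)
  qed (use Halpha_closed in \<open>auto simp: fun_eq_iff algebra_simps\<close>)
  have mon: "Group.comm_monoid (Halpha n)"
  proof (rule comm_monoidI)
    show "\<one>\<^bsub>Halpha n\<^esub> \<otimes>\<^bsub>Halpha n\<^esub> f = f" if f: "f \<in> carrier (Halpha n)" for f
      using ext[OF f] by (simp cong: restrict_cong)
  qed (use Halpha_closed in \<open>auto simp: fun_eq_iff algebra_simps\<close>)
  have cr: "cring (Halpha n)"
    by (rule cringI[OF grp mon]) (auto simp: fun_eq_iff algebra_simps)
  show ?thesis
  proof (rule algebraI[OF cring_poly_ring cr])
    show "\<one>\<^bsub>poly_ring (n + 1)\<^esub> \<odot>\<^bsub>Halpha n\<^esub> f = f" if f: "f \<in> carrier (Halpha n)" for f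
      using ext[OF f] by simp
  qed (use Halpha_closed in \<open>auto simp: fun_eq_iff algebra_simps\<close>)
qed

end

theory Submission
  imports
    Defs
    "HOL-Computational_Algebra.Polynomial"
    "HOL-Combinatorics.Multiset_Permutations"
begin

text \<open>
  Write a permutation \<open>u\<close> as the list of its values and induct on the number of values. On the
  lists starting with \<open>a\<close> the class \<open>f\<close> satisfies the divisibility conditions for the remaining
  values, so it has an expansion with coefficients \<open>g a J\<close>. Setting \<open>x\<^sub>a = x\<^sub>b\<close> identifies the
  monomials at \<open>u\<close> with those at \<open>u\<close> with \<open>a\<close> and \<open>b\<close> exchanged. As the monomials are
  linearly independent over any domain in which the evaluation points are distinct (a nonzero
  polynomial has no more roots than its degree), \<open>x\<^sub>a - x\<^sub>b\<close> divides \<open>g a J - g b J\<close>. Newton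
  interpolation then writes \<open>g a J\<close> as a polynomial in \<open>x\<^sub>a\<close> whose degree is less than the number
  of values, with coefficients that do not depend on \<open>a\<close>.
\<close>

section \<open>Substitution of variables\<close>

text \<open>Names the inner product of \<open>perm_act\<close> so that its multiplicativity can be
  stated. The map \<open>w\<close> is arbitrary: besides permutations, substitutions that identify
  variables are used below.\<close>

definition monom_at :: "(nat \<Rightarrow> nat) \<Rightarrow> (nat \<Rightarrow>\<^sub>0 nat) \<Rightarrow> rpoly" where
  "monom_at w e = (\<Prod>i \<in> Poly_Mapping.keys e. X (w i) ^ Poly_Mapping.lookup e i)"

lemma monom_at_superset:
  assumes "finite S" "Poly_Mapping.keys e \<subseteq> S"
  shows "monom_at w e = (\<Prod>i\<in>S. X (w i) ^ Poly_Mapping.lookup e i)"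
  unfolding monom_at_def using assms
  by (intro prod.mono_neutral_left) (auto simp: in_keys_iff)

lemma monom_at_add: "monom_at w (d + e) = monom_at w d * monom_at w e"
proof -
  let ?S = "Poly_Mapping.keys d \<union> Poly_Mapping.keys e"
  have "Poly_Mapping.keys (d + e) \<subseteq> ?S"
    by (rule Poly_Mapping.keys_add)
  then show ?thesis
    by (simp add: monom_at_superset[of ?S] lookup_add power_add prod.distrib)
qed

lemma monom_at_zero [simp]: "monom_at w 0 = 1"
  by (simp add: monom_at_def)

lemma poly_mapping_eq_sum_single:
  "p = (\<Sum>e\<in>Poly_Mapping.keys p. Poly_Mapping.single e (Poly_Mapping.lookup p e))"
  by (rule poly_mapping_eqI)
    (auto simp: lookup_sum lookup_single when_def sum.delta' in_keys_iff)

lemma perm_act_superset: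
  assumes "finite S" "Poly_Mapping.keys p \<subseteq> S"
  shows "perm_act w p =
    (\<Sum>e\<in>S. Poly_Mapping.single 0 (Poly_Mapping.lookup p e) * monom_at w e)"
  unfolding perm_act_def monom_at_def using assms
  by (intro sum.mono_neutral_left) (auto simp: in_keys_iff)

lemma perm_act_zero [simp]: "perm_act w 0 = 0"
  by (simp add: perm_act_def)

lemma perm_act_add: "perm_act w (p + q) = perm_act w p + perm_act w q"
proof -
  let ?S = "Poly_Mapping.keys p \<union> Poly_Mapping.keys q"
  have "Poly_Mapping.keys (p + q) \<subseteq> ?S"
    by (rule Poly_Mapping.keys_add)
  then show ?thesis
    by (simp add: perm_act_superset[of ?S] lookup_add single_add distrib_right sum.distrib)
qed

lemma perm_act_sum: "perm_act w (\<Sum>i\<in>I. f i) = (\<Sum>i\<in>I. perm_act w (f i))"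
  by (induction I rule: infinite_finite_induct) (simp_all add: perm_act_add)

lemma perm_act_diff: "perm_act w (p - q) = perm_act w p - perm_act w q"
  by (metis add_diff_cancel_right' diff_add_cancel perm_act_add)

lemma perm_act_single:
  "perm_act w (Poly_Mapping.single e c) = Poly_Mapping.single 0 c * monom_at w e"
  by (simp add: perm_act_superset[of "{e}"])

lemma perm_act_one [simp]: "perm_act w 1 = 1"
  using perm_act_single[of w 0 1] by simp

lemma perm_act_X [simp]: "perm_act w (X i) = X (w i)"
  by (simp add: X_def perm_act_single) (simp add: monom_at_def X_def)

text \<open>By additivity it suffices to compare products of single terms, where
  \<open>monom_at_add\<close> applies.\<close>

lemma perm_act_mult: "perm_act w (p * q) = perm_act w p * perm_act w q"
proof -
  have *: "perm_act w (Poly_Mapping.single d a * Poly_Mapping.single e b) =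
      perm_act w (Poly_Mapping.single d a) * perm_act w (Poly_Mapping.single e b)"
    for d e :: "nat \<Rightarrow>\<^sub>0 nat" and a b :: real
  proof -
    have "Poly_Mapping.single (0 :: nat \<Rightarrow>\<^sub>0 nat) (a * b) =
        Poly_Mapping.single 0 a * Poly_Mapping.single 0 b"
      by (simp add: mult_single)
    then show ?thesis
      by (simp add: mult_single perm_act_single monom_at_add mult_ac)
  qed
  show ?thesis
    by (subst (1 2) poly_mapping_eq_sum_single[of p], subst (1 2) poly_mapping_eq_sum_single[of q])
      (simp only: sum_product perm_act_sum *)
qed

lemma perm_act_power: "perm_act w (p ^ k) = perm_act w p ^ k"
  by (induction k) (simp_all add: perm_act_mult)

lemma perm_act_prod: "perm_act w (\<Prod>i\<in>I. f i) = (\<Prod>i\<in>I. perm_act w (f i))"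
  by (induction I rule: infinite_finite_induct) (simp_all add: perm_act_mult)

lemma X_power: "X i ^ k = Poly_Mapping.single (Poly_Mapping.single i k) 1"
  by (induction k) (simp_all add: X_def mult_single flip: single_add)

lemma monom_at_id: "monom_at id e = Poly_Mapping.single e 1"
proof -
  have "(\<Prod>i\<in>S. Poly_Mapping.single (f i) 1) = (Poly_Mapping.single (\<Sum>i\<in>S. f i) 1 :: rpoly)"
    if "finite S" for S :: "nat set" and f
    using that by (induction S) (simp_all add: mult_single)
  then show ?thesis
    by (simp add: monom_at_def X_power flip: poly_mapping_eq_sum_single)
qed

lemma perm_act_id [simp]: "perm_act id p = p"
  by (subst (2) poly_mapping_eq_sum_single)
    (simp add: perm_act_superset[OF _ subset_refl] monom_at_id mult_single)

section \<open>Congruences and divisibility by \<open>X a - X b\<close>\<close>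

lemma dvd_mult_diff:
  fixes d :: "'a::comm_ring_1"
  assumes "d dvd a - b" "d dvd a' - b'"
  shows "d dvd a * a' - b * b'"
proof -
  have "a * a' - b * b' = a * (a' - b') + (a - b) * b'"
    by (simp add: algebra_simps)
  then show ?thesis
    using assms by simp
qed

lemma dvd_prod_diff:
  fixes d :: "'a::comm_ring_1"
  assumes "\<And>i. i \<in> I \<Longrightarrow> d dvd f i - g i"
  shows "d dvd (\<Prod>i\<in>I. f i) - (\<Prod>i\<in>I. g i)"
  using assms by (induction I rule: infinite_finite_induct) (simp_all add: dvd_mult_diff)

lemma dvd_power_diff:
  fixes d :: "'a::comm_ring_1"
  assumes "d dvd a - b"
  shows "d dvd a ^ k - b ^ k"
  using assms by (induction k) (simp_all add: dvd_mult_diff)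

text \<open>Modulo \<open>d\<close> each variable is congruent to its image, and congruences pass
  through powers, products and sums.\<close>

lemma dvd_diff_perm_act:
  assumes "\<And>i. d dvd X i - X (w i)"
  shows "d dvd p - perm_act w p"
proof -
  have "p - perm_act w p = perm_act id p - perm_act w p"
    by simp
  also have "\<dots> = (\<Sum>e\<in>Poly_Mapping.keys p.
      Poly_Mapping.single 0 (Poly_Mapping.lookup p e) * (monom_at id e - monom_at w e))"
    by (simp only: perm_act_superset[OF finite_keys subset_refl] right_diff_distrib sum_subtractf)
  also have "d dvd \<dots>"
    unfolding monom_at_def using assms
    by (intro dvd_sum dvd_mult dvd_prod_diff dvd_power_diff) simp
  finally show ?thesis .
qed

lemma X_eq_iff [simp]: "X a = X b \<longleftrightarrow> a = b"
  unfolding X_def by (metis keys_single singleton_inject zero_neq_one)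

text \<open>The factor theorem: substituting \<open>X b\<close> for \<open>X a\<close> kills
  \<open>X a - X b\<close>, and conversely it changes \<open>p\<close> only by a multiple of
  \<open>X a - X b\<close>. Divisibility thus becomes an equation under a ring homomorphism.\<close>

lemma X_diff_dvd_iff: "X a - X b dvd p \<longleftrightarrow> perm_act (id(a := b)) p = 0"
proof
  assume "X a - X b dvd p"
  then show "perm_act (id(a := b)) p = 0"
    by (auto simp: dvd_def perm_act_mult perm_act_diff)
next
  assume "perm_act (id(a := b)) p = 0"
  with dvd_diff_perm_act[of "X a - X b" "id(a := b)" p] show "X a - X b dvd p"
    by simp
qed

text \<open>Substituting \<open>X b\<close> for \<open>X a\<close> turns \<open>X a - X c\<close>
  into \<open>X b - X c\<close>, which is nonzero and cancels in the domain.\<close>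

lemma X_diff_dvd_cancel:
  assumes "X a - X b dvd (X a - X c) * p" "a \<noteq> c" "b \<noteq> c"
  shows "X a - X b dvd p"
  using assms by (auto simp: X_diff_dvd_iff perm_act_mult perm_act_diff)

section \<open>The subring of polynomials in the first \<open>m\<close> variables\<close>

lemma poly_ring_sum:
  "(\<And>i. i \<in> I \<Longrightarrow> f i \<in> carrier (poly_ring m)) \<Longrightarrow> (\<Sum>i\<in>I. f i) \<in> carrier (poly_ring m)"
  by (induction I rule: infinite_finite_induct) (simp_all add: poly_ring_closed)

lemma poly_ring_prod:
  "(\<And>i. i \<in> I \<Longrightarrow> f i \<in> carrier (poly_ring m)) \<Longrightarrow> (\<Prod>i\<in>I. f i) \<in> carrier (poly_ring m)"
  by (induction I rule: infinite_finite_induct) (simp_all add: poly_ring_closed)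

lemma poly_ring_power: "p \<in> carrier (poly_ring m) \<Longrightarrow> p ^ k \<in> carrier (poly_ring m)"
  by (induction k) (simp_all add: poly_ring_closed)

lemma poly_ring_diff:
  "p \<in> carrier (poly_ring m) \<Longrightarrow> q \<in> carrier (poly_ring m) \<Longrightarrow> p - q \<in> carrier (poly_ring m)"
  using poly_ring_add[of p m "- q"] poly_ring_uminus[of q m] by simp

lemma poly_ring_const: "Poly_Mapping.single 0 c \<in> carrier (poly_ring m)"
  by (simp add: poly_ring_def)

lemma poly_ring_X: "i \<in> {1..m} \<Longrightarrow> X i \<in> carrier (poly_ring m)"
  by (simp add: poly_ring_def X_def)

lemma perm_act_closed:
  assumes "range w \<subseteq> {1..m}"
  shows "perm_act w p \<in> carrier (poly_ring m)"
  unfolding perm_act_def using assms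
  by (intro poly_ring_sum poly_ring_mult poly_ring_prod poly_ring_power poly_ring_const poly_ring_X)
    (simp_all only: image_subset_iff UNIV_I simp_thms)

lemma perm_act_cong_carrier:
  assumes "p \<in> carrier (poly_ring m)" "\<And>i. i \<in> {1..m} \<Longrightarrow> v i = w i"
  shows "perm_act v p = perm_act w p"
  unfolding perm_act_def using assms
  by (intro sum.cong prod.cong arg_cong2[where f = "(*)"]) (auto simp: poly_ring_def subset_iff)

text \<open>
  Sending all variables outside \<open>{1..m}\<close> to \<open>x\<^sub>1\<close> retracts the ambient ring onto \<open>\<real>[x\<^sub>1, \<dots>, x\<^sub>m]\<close>.
  Hence divisibility and linear combinations may be computed in the ambient integral domain.
\<close>

definition retract_vars :: "nat \<Rightarrow> nat \<Rightarrow> nat" where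
  "retract_vars m i = (if i \<in> {1..m} then i else 1)"

lemma perm_act_retract_closed: "m \<ge> 1 \<Longrightarrow> perm_act (retract_vars m) p \<in> carrier (poly_ring m)"
  by (rule perm_act_closed) (auto simp: retract_vars_def)

lemma perm_act_retract_carrier:
  assumes "p \<in> carrier (poly_ring m)"
  shows "perm_act (retract_vars m) p = p"
  using perm_act_cong_carrier[OF assms, of "retract_vars m" id] by (simp add: retract_vars_def)

lemma divides_poly_ring_iff_dvd:
  assumes "m \<ge> 1" "p \<in> carrier (poly_ring m)" "q \<in> carrier (poly_ring m)"
  shows "p divides\<^bsub>poly_ring m\<^esub> q \<longleftrightarrow> p dvd q"
proof
  assume "p dvd q"
  then obtain c where "q = p * c"
    by (auto simp: dvd_def)
  \<comment> \<open>The retraction fixes \<open>p\<close> and \<open>q\<close> and moves the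
    quotient into the subring.\<close>
  then have "q = p * perm_act (retract_vars m) c"
    using assms by (metis perm_act_mult perm_act_retract_carrier)
  then show "p divides\<^bsub>poly_ring m\<^esub> q"
    unfolding factor_def using assms perm_act_retract_closed by (auto intro!: bexI)
qed (auto simp: factor_def)

section \<open>Expansions on arrangements of a finite set\<close>

text \<open>Induction on \<open>V\<close>: the divided differences of \<open>g\<close> at a new node
  \<open>v\<close> again satisfy the hypothesis, and an interpolant \<open>p\<close> for them gives
  \<open>g v + (x - X v) * p\<close> for \<open>g\<close>. The alternative \<open>p = 0\<close>
  covers the empty set, as the zero polynomial has degree 0.\<close>

lemma newton_interpolation:
  assumes "finite V" "\<And>a b. a \<in> V \<Longrightarrow> b \<in> V \<Longrightarrow> X a - X b dvd g a - g b"
  shows "\<exists>p. (p = 0 \<or> degree p < card V) \<and> (\<forall>a\<in>V. poly p (X a) = g a)"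
  using assms
proof (induction V arbitrary: g rule: finite_induct)
  case empty
  then show ?case by auto
next
  case (insert v V)
  have "\<forall>a\<in>V. \<exists>q. g a - g v = (X a - X v) * q"
    using insert.prems by (auto simp: dvd_def)
  then obtain h where h: "\<And>a. a \<in> V \<Longrightarrow> g a - g v = (X a - X v) * h a"
    by metis
  have "X a - X b dvd h a - h b" if ab: "a \<in> V" "b \<in> V" for a b
  proof -
    \<comment> \<open>Both the left side and the last summand are multiples of
      \<open>X a - X b\<close>. So is the remaining product, and its factor \<open>X a - X v\<close>
      can be cancelled because \<open>v\<close> is a new node.\<close>
    have "g a - g b = (X a - X v) * (h a - h b) + (X a - X b) * h b"
    proof -
      have "g a - g b = (X a - X v) * h a - (X b - X v) * h b"
        using h[OF ab(1)] h[OF ab(2)] by (metis diff_diff_eq2 diff_add_cancel)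
      then show ?thesis by (simp add: algebra_simps)
    qed
    moreover have "X a - X b dvd g a - g b"
      using insert.prems ab by simp
    ultimately have "X a - X b dvd (X a - X v) * (h a - h b)"
      by (simp add: dvd_add_left_iff)
    then show ?thesis
      by (rule X_diff_dvd_cancel) (use ab insert.hyps in auto)
  qed
  then obtain p where p: "p = 0 \<or> degree p < card V" "\<forall>a\<in>V. poly p (X a) = h a"
    using insert.IH[of h] by blast
  let ?q = "[:- X v, 1:] * p"
  have "degree ?q \<le> card V"
    using p(1) degree_mult_le[of "[:- X v, 1:]" p] by (auto simp del: mult_pCons_left)
  then have "degree ([:g v:] + ?q) \<le> card V"
    by (intro degree_add_le) simp_all
  moreover have "poly ([:g v:] + ?q) (X a) = g a" if "a \<in> insert v V" for a
  proof (cases "a = v")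
    case False
    then have "a \<in> V"
      using that by simp
    then have "poly ([:g v:] + ?q) (X a) = g v + (X a - X v) * h a"
      using p(2) by (simp add: algebra_simps)
    also have "\<dots> = g a"
      using h[OF \<open>a \<in> V\<close>] by (metis add.commute diff_add_cancel)
    finally show ?thesis .
  qed simp
  ultimately show ?case
    using insert.hyps by (intro exI[of _ "[:g v:] + ?q"]) auto
qed

text \<open>The product runs over the exponents, so \<open>ys\<close> may be longer than
  \<open>J\<close>: in an arrangement of \<open>n + 1\<close> values the last one carries no
  exponent.\<close>

definition list_monom :: "'a::comm_monoid_mult list \<Rightarrow> nat list \<Rightarrow> 'a" where
  "list_monom ys J = (\<Prod>k<length J. (ys ! k) ^ (J ! k))"

lemma list_monom_Nil [simp]: "list_monom ys [] = 1"
  by (simp add: list_monom_def)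

lemma list_monom_Cons [simp]: "list_monom (y # ys) (j # J) = y ^ j * list_monom ys J"
  by (simp add: list_monom_def prod.lessThan_Suc_shift del: prod.lessThan_Suc)

lemma perm_act_list_monom:
  assumes "length J \<le> length us"
  shows "perm_act w (list_monom (map X us) J) = list_monom (map X (map w us)) J"
  using assms by (simp add: list_monom_def perm_act_prod perm_act_power)

lemma A_set_0 [simp]: "A_set 0 = {[]}"
  by (auto simp: A_set_def)

text \<open>The bound on an exponent depends only on how many positions follow it, so deleting the
  first position preserves the shape of the index set.\<close>

lemma Cons_in_A_set_Suc_iff: "j # J \<in> A_set (Suc n) \<longleftrightarrow> J \<in> A_set n \<and> j \<le> Suc n"
proof -
  have A: "I \<in> A_set m \<longleftrightarrow> length I = m \<and> (\<forall>k<m. I ! k \<le> m - k)" for I m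
  proof -
    have "{1..m} = Suc ` {..<m}"
      by (simp add: image_Suc_lessThan)
    then show ?thesis
      unfolding A_set_def by auto
  qed
  show ?thesis
    unfolding A by (auto simp: less_Suc_eq_0_disj)
qed

lemma A_set_Suc: "A_set (Suc n) = (\<lambda>(J, j). j # J) ` (A_set n \<times> {..Suc n})"
proof (intro equalityI subsetI)
  fix K assume K: "K \<in> A_set (Suc n)"
  then have "K \<noteq> []"
    by (auto simp: A_set_def)
  then obtain j J where "K = j # J"
    by (auto simp: neq_Nil_conv)
  then show "K \<in> (\<lambda>(J, j). j # J) ` (A_set n \<times> {..Suc n})"
    using K by (auto simp: Cons_in_A_set_Suc_iff)
qed (auto simp: Cons_in_A_set_Suc_iff)

lemma finite_A_set: "finite (A_set n)"
  by (induction n) (simp_all add: A_set_Suc)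

lemma length_A_set: "J \<in> A_set n \<Longrightarrow> length J = n"
  by (simp add: A_set_def)

lemma sum_A_set_Suc: "(\<Sum>K\<in>A_set (Suc n). F K) = (\<Sum>J\<in>A_set n. \<Sum>j\<le>Suc n. F (j # J))"
  unfolding A_set_Suc by (subst sum.reindex)
    (auto simp: inj_on_def sum.cartesian_product comp_def case_prod_unfold simp del: sum.atMost_Suc)

lemma Cons_in_permutations_of_set_iff:
  "a # us \<in> permutations_of_set V \<longleftrightarrow> a \<in> V \<and> us \<in> permutations_of_set (V - {a})"
  by (auto simp: permutations_of_set_def)

section \<open>Linear independence of the monomials\<close>

lemma coeffs_eq_zero_if_many_roots:
  fixes r :: "nat \<Rightarrow> 'a::idom"
  assumes "n < card S" "\<And>x. x \<in> S \<Longrightarrow> (\<Sum>i\<le>n. r i * x ^ i) = 0" "i \<le> n"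
  shows "r i = 0"
proof -
  let ?p = "\<Sum>i\<le>n. Polynomial.monom (r i) i"
  have "?p = 0"
  proof (rule poly_eqI_degree[of S])
    have "degree ?p \<le> n"
      by (intro degree_sum_le) (auto intro: order.trans[OF degree_monom_le])
    then show "degree ?p < card S"
      using assms(1) by simp
  qed (use assms in \<open>simp_all add: poly_sum poly_monom\<close>)
  then have "poly.coeff ?p i = 0"
    by simp
  then show ?thesis
    using assms(3) by (simp add: coeff_sum)
qed

text \<open>Fixing the first value \<open>a\<close> and grouping by the first exponent, the
  induction hypothesis on \<open>V - {a}\<close> kills a polynomial in \<open>y a\<close> of degree
  at most \<open>n + 1\<close>. This happens at \<open>n + 2\<close> distinct points, so its
  coefficients vanish. General points \<open>y\<close> allow the use after a substitution of
  variables.\<close>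

lemma list_monom_independent:
  fixes y :: "'v \<Rightarrow> 'a::idom"
  assumes "card V = Suc n" "inj_on y V"
    and "\<And>us. us \<in> permutations_of_set V \<Longrightarrow> (\<Sum>J\<in>A_set n. r J * list_monom (map y us) J) = 0"
    and "J \<in> A_set n"
  shows "r J = 0"
  using assms
proof (induction n arbitrary: V r J)
  case 0
  then obtain a where "V = {a}"
    by (auto simp: card_Suc_eq)
  with "0.prems"(3)[of "[a]"] "0.prems"(4) show ?case
    by (simp add: permutations_of_set_def)
next
  case (Suc n)
  obtain i J' where J: "J = i # J'" "J' \<in> A_set n" "i \<le> Suc n"
    using Suc.prems(4) by (auto simp: A_set_Suc)
  have "(\<Sum>j\<le>Suc n. r (j # J') * y a ^ j) = 0" if a: "a \<in> V" for a
  proof (rule Suc.IH[of "V - {a}" "\<lambda>J. \<Sum>j\<le>Suc n. r (j # J) * y a ^ j"])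
    show "card (V - {a}) = Suc n"
      using a Suc.prems(1) by (simp add: card_Diff_singleton)
    show "inj_on y (V - {a})"
      using Suc.prems(2) by (rule inj_on_subset) auto
    show "(\<Sum>J\<in>A_set n. (\<Sum>j\<le>Suc n. r (j # J) * y a ^ j) * list_monom (map y us) J) = 0"
      if "us \<in> permutations_of_set (V - {a})" for us
      using Suc.prems(3)[of "a # us"] that a
      by (simp add: Cons_in_permutations_of_set_iff sum_A_set_Suc sum_distrib_right mult.assoc
          del: sum.atMost_Suc)
  qed (rule J(2))
  then have "r (i # J') = 0"
    using Suc.prems(1,2) J(3)
    by (intro coeffs_eq_zero_if_many_roots[of "Suc n" "y ` V" "\<lambda>j. r (j # J')"])
      (auto simp: card_image)
  then show ?case
    by (simp add: J(1))
qed

text \<open>Under the substitution of \<open>X b\<close> for \<open>X a\<close> both expansions use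
  the same monomials, and the difference of their values vanishes. The substitution fixes the
  variables indexed by \<open>V - {a}\<close>, so these monomials are still independent and the
  coefficients agree.\<close>

lemma coeff_difference_dvd:
  assumes V: "card V = Suc (Suc n)" "a \<in> V" "b \<in> V" "a \<noteq> b"
    and a: "\<And>us. us \<in> permutations_of_set (V - {a}) \<Longrightarrow>
      f (a # us) = (\<Sum>J\<in>A_set n. ga J * list_monom (map X us) J)"
    and b: "\<And>us. us \<in> permutations_of_set (V - {b}) \<Longrightarrow>
      f (b # us) = (\<Sum>J\<in>A_set n. gb J * list_monom (map X us) J)"
    and dvd: "\<And>us k. us \<in> permutations_of_set (V - {a}) \<Longrightarrow> k < length us \<Longrightarrow> us ! k = b \<Longrightarrow>
      X a - X b dvd f (b # us[k := a]) - f (a # us)"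
    and J: "J \<in> A_set n"
  shows "X a - X b dvd ga J - gb J"
proof -
  define w where "w = id(a := b)"
  have "perm_act w (ga J - gb J) = 0"
  proof (rule list_monom_independent[of "V - {a}" n "\<lambda>v. X (w v)"
        "\<lambda>J. perm_act w (ga J - gb J)" J])
    show "card (V - {a}) = Suc n"
      using V by (simp add: card_Diff_singleton)
    show "inj_on (\<lambda>v. X (w v)) (V - {a})"
      by (auto simp: inj_on_def w_def)
    show "(\<Sum>J\<in>A_set n. perm_act w (ga J - gb J) * list_monom (map (\<lambda>v. X (w v)) us) J) = 0"
      if us: "us \<in> permutations_of_set (V - {a})" for us
    proof -
      have us': "set us = V - {a}" "distinct us"
        using us by (simp_all add: permutations_of_set_def)
      then obtain k where k: "k < length us" "us ! k = b"
        using V by (metis DiffI in_set_conv_nth singletonD)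
      have "length us = Suc n"
        using us' V(1,2) by (metis card_Diff_singleton diff_Suc_1 distinct_card)
      have "set (us[k := a]) = V - {b}"
        using us' k V by (simp add: set_update_distinct insert_Diff_if) blast
      moreover have "distinct (us[k := a])"
        using us' by (simp add: distinct_list_update)
      ultimately have us'': "us[k := a] \<in> permutations_of_set (V - {b})"
        by (rule permutations_of_setI)
      \<comment> \<open>The two lists differ only at position \<open>k\<close>, where the entries
        are \<open>a\<close> and \<open>b\<close>; \<open>w\<close> sends both to
        \<open>b\<close>.\<close>
      have map_eq: "map w (us[k := a]) = map w us"
        using k by (intro nth_equalityI) (auto simp: nth_list_update w_def)
      have "perm_act w (list_monom (map X us') J) = list_monom (map (\<lambda>v. X (w v)) us) J"
        if "us' = us \<or> us' = us[k := a]" "J \<in> A_set n" for us' J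
        using that map_eq \<open>length us = Suc n\<close> length_A_set[of J n]
        by (subst perm_act_list_monom) (auto simp del: map_map, simp_all add: comp_def)
      then have "perm_act w (f (b # us[k := a])) =
            (\<Sum>J\<in>A_set n. perm_act w (gb J) * list_monom (map (\<lambda>v. X (w v)) us) J)"
          "perm_act w (f (a # us)) =
            (\<Sum>J\<in>A_set n. perm_act w (ga J) * list_monom (map (\<lambda>v. X (w v)) us) J)"
        using a[OF us] b[OF us''] by (simp_all add: perm_act_sum perm_act_mult)
      moreover have "perm_act w (f (b # us[k := a]) - f (a # us)) = 0"
        using dvd[OF us k] by (simp add: X_diff_dvd_iff w_def)
      ultimately show ?thesis
        by (simp add: perm_act_diff left_diff_distrib sum_subtractf)
    qed
  qed (rule J)
  then show ?thesis
    by (simp add: X_diff_dvd_iff w_def)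
qed

lemma list_monom_span:
  assumes "card V = Suc n"
    and "\<And>us i j. us \<in> permutations_of_set V \<Longrightarrow> i < j \<Longrightarrow> j < length us \<Longrightarrow>
      X (us ! i) - X (us ! j) dvd f (us[i := us ! j, j := us ! i]) - f us"
  shows "\<exists>r. \<forall>us\<in>permutations_of_set V. f us = (\<Sum>J\<in>A_set n. r J * list_monom (map X us) J)"
  using assms
proof (induction n arbitrary: V f)
  case 0
  then obtain a where "V = {a}"
    by (auto simp: card_Suc_eq)
  then show ?case
    by (intro exI[of _ "\<lambda>_. f [a]"]) simp
next
  case (Suc n)
  have fin: "finite V"
    using Suc.prems(1) card.infinite by force
  have "\<exists>g. \<forall>us\<in>permutations_of_set (V - {a}).
      f (a # us) = (\<Sum>J\<in>A_set n. g J * list_monom (map X us) J)" if a: "a \<in> V" for a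
  proof (rule Suc.IH)
    show "card (V - {a}) = Suc n"
      using a Suc.prems(1) by (simp add: card_Diff_singleton)
    show "X (us ! i) - X (us ! j) dvd f (a # us[i := us ! j, j := us ! i]) - f (a # us)"
      if "us \<in> permutations_of_set (V - {a})" "i < j" "j < length us" for us i j
      \<comment> \<open>An exchange inside the tail is an exchange in \<open>a # us\<close> with
        both positions shifted by one.\<close>
      using Suc.prems(2)[of "a # us" "Suc i" "Suc j"] that a
      by (simp add: Cons_in_permutations_of_set_iff)
  qed
  then obtain g where g: "\<And>a us. a \<in> V \<Longrightarrow> us \<in> permutations_of_set (V - {a}) \<Longrightarrow>
      f (a # us) = (\<Sum>J\<in>A_set n. g a J * list_monom (map X us) J)"
    by metis
  have "X a - X b dvd g a J - g b J" if "a \<in> V" "b \<in> V" "J \<in> A_set n" for a b J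
  proof (cases "a = b")
    case False
    show ?thesis
    proof (rule coeff_difference_dvd[OF Suc.prems(1) that(1,2) False, of f])
      show "X a - X b dvd f (b # us[k := a]) - f (a # us)"
        if "us \<in> permutations_of_set (V - {a})" "k < length us" "us ! k = b" for us k
        \<comment> \<open>Exchanging the head with position \<open>k\<close> of the tail swaps the
          values \<open>a\<close> and \<open>b\<close>.\<close>
        using Suc.prems(2)[of "a # us" 0 "Suc k"] that \<open>a \<in> V\<close>
        by (simp add: Cons_in_permutations_of_set_iff)
    qed (use g that in simp_all)
  qed simp
  then have "\<forall>J\<in>A_set n. \<exists>p. (p = 0 \<or> degree p < card V) \<and> (\<forall>a\<in>V. poly p (X a) = g a J)"
    by (intro ballI newton_interpolation fin)
  then obtain p where p: "\<And>J. J \<in> A_set n \<Longrightarrow> p J = 0 \<or> degree (p J) < card V"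
      "\<And>J a. J \<in> A_set n \<Longrightarrow> a \<in> V \<Longrightarrow> poly (p J) (X a) = g a J"
    by metis
  \<comment> \<open>As \<open>card V = n + 2\<close>, the interpolant has degree at most
    \<open>n + 1\<close>, exactly the bound on the first exponent in
    \<open>A_set (Suc n)\<close>.\<close>
  have g_eq: "g a J = (\<Sum>i\<le>Suc n. poly.coeff (p J) i * X a ^ i)" if "J \<in> A_set n" "a \<in> V" for J a
  proof -
    have "degree (p J) \<le> Suc n"
      using p(1)[OF that(1)] Suc.prems(1) by auto
    then have "(\<Sum>i\<le>degree (p J). poly.coeff (p J) i * X a ^ i) =
        (\<Sum>i\<le>Suc n. poly.coeff (p J) i * X a ^ i)"
      by (intro sum.mono_neutral_left) (auto simp: coeff_eq_0)
    then show ?thesis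
      using p(2)[OF that] by (simp add: poly_altdef)
  qed
  have "f us = (\<Sum>K\<in>A_set (Suc n). poly.coeff (p (tl K)) (hd K) * list_monom (map X us) K)"
    if us: "us \<in> permutations_of_set V" for us
  proof -
    have "us \<noteq> []"
      using us Suc.prems(1) by (auto simp: permutations_of_set_def)
    then obtain a us' where [simp]: "us = a # us'"
      by (auto simp: neq_Nil_conv)
    have a: "a \<in> V" "us' \<in> permutations_of_set (V - {a})"
      using us by (simp_all add: Cons_in_permutations_of_set_iff)
    show ?thesis
      using g[OF a] a(1)
      by (simp add: sum_A_set_Suc g_eq sum_distrib_right mult.assoc del: sum.atMost_Suc)
  qed
  then show ?case
    by (intro exI[of _ "\<lambda>K. poly.coeff (p (tl K)) (hd K)"]) blast
qed

section \<open>The classes \<open>c\<^sub>I\<close>\<close>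

text \<open>Composing with a transposition of positions becomes an exchange of list entries. Lists
  count from 0, so entry \<open>i\<close> is the value at \<open>Suc i\<close>.\<close>

definition one_line :: "nat \<Rightarrow> (nat \<Rightarrow> nat) \<Rightarrow> nat list" where
  "one_line m u = map u [1..<Suc m]"

lemma bij_betw_one_line: "bij_betw (one_line m) (Sym m) (permutations_of_set {1..m})"
proof (rule bij_betw_imageI)
  show "inj_on (one_line m) (Sym m)"
  proof (rule inj_onI)
    fix u v assume "u \<in> Sym m" "v \<in> Sym m" "one_line m u = one_line m v"
    then have "u i = v i" for i
      by (cases "i \<in> {1..m}") (auto simp: one_line_def Sym_def permutes_def simp del: upt_Suc)
    then show "u = v" ..
  qed
  have "one_line m u \<in> permutations_of_set {1..m}" if "u \<in> Sym m" for u
  proof (rule permutations_of_setI)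
    have u: "u permutes {1..m}"
      using that by (simp add: Sym_def)
    show "set (one_line m u) = {1..m}"
      using permutes_image[OF u] by (simp add: one_line_def atLeastLessThanSuc_atLeastAtMost del: upt_Suc)
    show "distinct (one_line m u)"
      using permutes_inj_on[OF u] by (simp add: one_line_def distinct_map)
  qed
  moreover have "us \<in> one_line m ` Sym m" if us: "us \<in> permutations_of_set {1..m}" for us
  proof -
    have us': "set us = {1..m}" "distinct us" "length us = m"
      using us distinct_card[of us] by (auto simp: permutations_of_set_def)
    \<comment> \<open>Outside \<open>{1..m}\<close> the identity is forced by
      \<open>permutes\<close>.\<close>
    define u where "u i = (if i \<in> {1..m} then us ! (i - 1) else i)" for i
    have eq: "one_line m u = us"
      using us'(3) by (intro nth_equalityI) (auto simp: one_line_def u_def simp del: upt_Suc)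
    have "u permutes {1..m}"
    proof (rule bij_imp_permutes)
      show "bij_betw u {1..m} {1..m}"
      proof (rule bij_betw_imageI)
        show "u ` {1..m} = {1..m}"
          using us'(1) unfolding eq[symmetric]
          by (simp add: one_line_def atLeastLessThanSuc_atLeastAtMost del: upt_Suc)
        show "inj_on u {1..m}"
          using us'(2) unfolding eq[symmetric]
          by (simp add: one_line_def distinct_map atLeastLessThanSuc_atLeastAtMost del: upt_Suc)
      qed
    qed (auto simp: u_def)
    then show ?thesis
      using eq by (auto simp: Sym_def)
  qed
  ultimately show "one_line m ` Sym m = permutations_of_set {1..m}"
    by blast
qed

lemma one_line_comp_transpose:
  assumes "i < j" "j < m"
  shows "one_line m (u \<circ> Transposition.transpose (Suc i) (Suc j)) =
    (one_line m u)[i := u (Suc j), j := u (Suc i)]"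
  using assms
  by (intro nth_equalityI)
    (auto simp: one_line_def nth_list_update Transposition.transpose_def simp del: upt_Suc)

lemma c_class_one_line:
  assumes "length I = n" "u \<in> Sym (n + 1)"
  shows "c_class n I u = list_monom (map X (one_line (n + 1) u)) I"
proof -
  have "(\<Prod>k = 1..n. X (u k) ^ (I ! (k - 1))) = (\<Prod>k<n. X (u (Suc k)) ^ (I ! k))"
    by (rule prod.reindex_bij_witness[of _ Suc "\<lambda>k. k - 1"]) auto
  then show ?thesis
    using assms by (simp add: c_class_def list_monom_def one_line_def del: upt_Suc)
qed

lemma Sym_app: "u \<in> Sym m \<Longrightarrow> i \<in> {1..m} \<Longrightarrow> u i \<in> {1..m}"
  by (auto simp: Sym_def dest: permutes_in_image)

lemma perm_act_c_class:
  assumes "u \<in> Sym (n + 1)"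
  shows "perm_act w (c_class n I u) = (\<Prod>k = 1..n. X (w (u k)) ^ (I ! (k - 1)))"
  using assms by (simp add: c_class_def perm_act_prod perm_act_power)

lemma c_class_closed: "c_class n I \<in> carrier (Halpha n)"
  unfolding c_class_def
proof (rule Halpha_carrierI)
  show *: "(\<Prod>k = 1..n. X (u k) ^ (I ! (k - 1))) \<in> carrier (poly_ring (n + 1))"
    if "u \<in> Sym (n + 1)" for u
    using Sym_app[OF that] by (intro poly_ring_prod poly_ring_power poly_ring_X) simp_all
  fix u i j
  assume u: "u \<in> Sym (n + 1)" and t: "u \<circ> Transposition.transpose i j \<in> Sym (n + 1)"
    and ij: "1 \<le> i" "i < j" "j \<le> n + 1"
  \<comment> \<open>After this substitution the values of the class at \<open>u\<close> and at
    \<open>u\<close> composed with the transposition coincide, factor by factor.\<close>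
  let ?w = "id(u i := u j)"
  have "?w ((u \<circ> Transposition.transpose i j) k) = ?w (u k)" for k
    by (auto simp: Transposition.transpose_def)
  then have "perm_act ?w (c_class n I (u \<circ> Transposition.transpose i j) - c_class n I u) = 0"
    by (simp only: perm_act_diff perm_act_c_class[OF u] perm_act_c_class[OF t] diff_self)
  then have "X (u i) - X (u j) dvd c_class n I (u \<circ> Transposition.transpose i j) - c_class n I u"
    by (simp only: X_diff_dvd_iff)
  moreover have "X (u i) \<in> carrier (poly_ring (n + 1))" "X (u j) \<in> carrier (poly_ring (n + 1))"
    using Sym_app[OF u, of i] Sym_app[OF u, of j] ij by (auto intro!: poly_ring_X)
  ultimately show "(X (u i) - X (u j)) divides\<^bsub>poly_ring (n + 1)\<^esub>
      ((\<Prod>k = 1..n. X ((u \<circ> Transposition.transpose i j) k) ^ (I ! (k - 1))) -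
       (\<Prod>k = 1..n. X (u k) ^ (I ! (k - 1))))"
    using u t *[OF u] *[OF t]
    by (subst divides_poly_ring_iff_dvd) (simp_all add: c_class_def poly_ring_diff)
qed

text \<open>The value at \<open>w \<circ> v\<close> involves the variables
  \<open>X (w (v k))\<close>, and acting by the inverse of \<open>w\<close> returns them to
  \<open>X (v k)\<close>.\<close>

lemma c_class_W_invariant: "W_invariant n (c_class n I)"
  unfolding W_invariant_def
proof
  fix w assume w: "w \<in> Sym (n + 1)"
  have "class_act n w (c_class n I) v = c_class n I v" for v
  proof (cases "v \<in> Sym (n + 1)")
    case True
    then have "w \<circ> v \<in> Sym (n + 1)"
      using w by (simp add: Sym_def permutes_compose)
    moreover have "Hilbert_Choice.inv w (w x) = x" for x
      using w by (simp add: Sym_def permutes_inverses)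
    ultimately show ?thesis
      using True by (simp add: class_act_def perm_act_c_class) (simp add: c_class_def)
  next
    case False
    then show ?thesis
      by (simp add: class_act_def c_class_def)
  qed
  then show "class_act n w (c_class n I) = c_class n I" ..
qed

section \<open>Independence and spanning for the classes\<close>

lemma c_class_independent:
  assumes "\<And>u. u \<in> Sym (n + 1) \<Longrightarrow> (\<Sum>I\<in>A_set n. r I * c_class n I u) = 0" "I \<in> A_set n"
  shows "r I = 0"
proof (rule list_monom_independent[of "{1..n + 1}" n X r])
  show "(\<Sum>J\<in>A_set n. r J * list_monom (map X us) J) = 0"
    if us: "us \<in> permutations_of_set {1..n + 1}" for us
  proof -
    obtain u where u: "u \<in> Sym (n + 1)" "us = one_line (n + 1) u"
      using us bij_betw_one_line[of "n + 1"] by (auto simp: bij_betw_def)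
    show ?thesis
      using assms(1)[OF u(1)] u by (simp add: c_class_one_line length_A_set)
  qed
qed (use assms(2) in \<open>simp_all add: inj_on_def\<close>)

lemma c_class_span:
  assumes f: "f \<in> carrier (Halpha n)"
  obtains r where "\<And>I. r I \<in> carrier (poly_ring (n + 1))"
    "\<And>u. u \<in> Sym (n + 1) \<Longrightarrow> f u = (\<Sum>I\<in>A_set n. r I * c_class n I u)"
proof -
  let ?m = "n + 1"
  \<comment> \<open>Transports \<open>f\<close> to arrangements, where
    \<open>list_monom_span\<close> applies.\<close>
  define F where "F us = f (inv_into (Sym ?m) (one_line ?m) us)" for us
  have F: "F (one_line ?m u) = f u" if "u \<in> Sym ?m" for u
    using that bij_betw_one_line[of ?m] by (simp add: F_def bij_betw_def)
  have "\<exists>r. \<forall>us\<in>permutations_of_set {1..?m}.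
      F us = (\<Sum>I\<in>A_set n. r I * list_monom (map X us) I)"
  proof (rule list_monom_span)
    fix us i j
    assume us: "us \<in> permutations_of_set {1..?m}" and ij: "i < j" "j < length us"
    obtain u where u: "u \<in> Sym ?m" "us = one_line ?m u"
      using us bij_betw_one_line[of ?m] by (auto simp: bij_betw_def)
    have j: "j < ?m"
      using ij u by (simp add: one_line_def del: upt_Suc)
    have nth: "us ! i = u (Suc i)" "us ! j = u (Suc j)"
      using ij j by (simp_all add: u(2) one_line_def del: upt_Suc)
    have "u \<circ> Transposition.transpose (Suc i) (Suc j) \<in> Sym ?m"
      using u(1) ij j by (intro Sym_comp_transpose) simp_all
    then have "F (us[i := us ! j, j := us ! i]) = f (u \<circ> Transposition.transpose (Suc i) (Suc j))"
      unfolding nth unfolding u(2) one_line_comp_transpose[OF ij(1) j, symmetric] by (rule F)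
    moreover have "X (u (Suc i)) - X (u (Suc j)) dvd
        f (u \<circ> Transposition.transpose (Suc i) (Suc j)) - f u"
      using Halpha_carrierD(2)[OF f u(1), of "Suc i" "Suc j"] ij(1) j by (auto simp: factor_def)
    ultimately show "X (us ! i) - X (us ! j) dvd F (us[i := us ! j, j := us ! i]) - F us"
      using F[OF u(1)] unfolding nth unfolding u(2) by simp
  qed simp
  then obtain r where r: "\<And>us. us \<in> permutations_of_set {1..?m} \<Longrightarrow>
      F us = (\<Sum>I\<in>A_set n. r I * list_monom (map X us) I)"
    by blast
  \<comment> \<open>The coefficients found so far lie in the ambient ring. The retraction brings
    them into the subring and fixes the values of \<open>f\<close> and of the classes, so the
    expansion survives.\<close>
  let ?r = "\<lambda>I. perm_act (retract_vars ?m) (r I)"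
  have "f u = (\<Sum>I\<in>A_set n. ?r I * c_class n I u)" if u: "u \<in> Sym ?m" for u
  proof -
    have "one_line ?m u \<in> permutations_of_set {1..?m}"
      using u bij_betw_one_line[of ?m] by (auto simp: bij_betw_def)
    then have "f u = (\<Sum>I\<in>A_set n. r I * c_class n I u)"
      using r F[OF u] u by (simp add: c_class_one_line length_A_set)
    then have "perm_act (retract_vars ?m) (f u) =
        (\<Sum>I\<in>A_set n. ?r I * perm_act (retract_vars ?m) (c_class n I u))"
      by (simp add: perm_act_sum perm_act_mult)
    then show ?thesis
      using Halpha_carrierD(1)[OF _ u] f c_class_closed by (simp add: perm_act_retract_carrier)
  qed
  then show ?thesis
    by (rule that[of ?r, OF perm_act_retract_closed, rotated]) simp_all
qed

text \<open>Two equal classes with different indices would give a relation with coefficients 1 and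
  -1, against independence.\<close>

lemma inj_on_c_class: "inj_on (c_class n) (A_set n)"
proof (rule inj_onI, rule ccontr)
  fix I J
  assume I: "I \<in> A_set n" and J: "J \<in> A_set n" and eq: "c_class n I = c_class n J" and "I \<noteq> J"
  define r :: "nat list \<Rightarrow> rpoly" where
    "r K = (if K = I then 1 else 0) - (if K = J then 1 else 0)" for K
  have "(\<Sum>K\<in>A_set n. r K * c_class n K u) = 0" for u
  proof -
    have "r K * c_class n K u =
        (if K = I then c_class n I u else 0) - (if K = J then c_class n J u else 0)" for K
      by (simp add: r_def)
    then show ?thesis
      using I J eq by (simp add: sum_subtractf finite_A_set)
  qed
  then have "r I = 0"
    using I by (rule c_class_independent)
  then show False
    using \<open>I \<noteq> J\<close> by (simp add: r_def)
qed

text \<open>Turns the abstract sums behind \<open>lincomb\<close> into pointwise sums of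
  polynomials.\<close>

lemma finsum_Halpha:
  assumes "finite B" "F \<in> B \<rightarrow> carrier (Halpha n)"
  shows "finsum (Halpha n) F B = (\<lambda>u \<in> Sym (n + 1). \<Sum>b\<in>B. F b u)"
proof -
  interpret algebra "poly_ring (n + 1)" "Halpha n"
    by (rule algebra_Halpha)
  show ?thesis
    using assms by (induction B) (auto simp: M.finsum_insert fun_eq_iff)
qed

theorem mainTheorem7:
  fixes n :: nat
  assumes "n \<ge> 2"
  shows "inj_on (c_class n) (A_set n) \<and>
    is_module_basis (poly_ring (n + 1)) (Halpha n) {c_class n I | I. I \<in> A_set n} \<and>
    (\<forall>I \<in> A_set n. W_invariant n (c_class n I))"
proof -
  let ?R = "poly_ring (n + 1)" and ?B = "c_class n ` A_set n"
  interpret algebra ?R "Halpha n"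
    by (rule algebra_Halpha)
  have mod: "Module.module ?R (Halpha n)" ..
  have B: "?B \<subseteq> carrier (Halpha n)" "finite ?B"
    using c_class_closed finite_A_set by auto
  \<comment> \<open>Injectivity of the indexing lets the sum over the set of classes be rewritten as
    a sum over \<open>A_set n\<close>.\<close>
  have lincomb: "lincomb a ?B = (\<lambda>u \<in> Sym (n + 1). \<Sum>I\<in>A_set n. a (c_class n I) * c_class n I u)"
    if "a \<in> ?B \<rightarrow> carrier ?R" for a
  proof -
    have "lincomb a ?B = (\<lambda>u \<in> Sym (n + 1). \<Sum>v\<in>?B. (a v \<odot>\<^bsub>Halpha n\<^esub> v) u)"
      unfolding lincomb_def using that B
      by (intro finsum_Halpha funcsetI smult_closed) auto
    also have "\<dots> = (\<lambda>u \<in> Sym (n + 1). \<Sum>I\<in>A_set n. a (c_class n I) * c_class n I u)"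
      by (auto simp: fun_eq_iff sum.reindex[OF inj_on_c_class])
    finally show ?thesis .
  qed
  have "\<not> lin_dep ?B"
  proof (rule finite_lin_indpt2[OF B(2,1)])
    fix a assume a: "a \<in> ?B \<rightarrow> carrier ?R" and "lincomb a ?B = \<zero>\<^bsub>Halpha n\<^esub>"
    then have "(\<Sum>I\<in>A_set n. a (c_class n I) * c_class n I u) = 0" if "u \<in> Sym (n + 1)" for u
      using that lincomb[OF a] by (simp add: fun_eq_iff) metis
    then show "\<forall>v\<in>?B. a v = \<zero>\<^bsub>?R\<^esub>"
      using c_class_independent[of n "\<lambda>I. a (c_class n I)"] by auto
  qed
  moreover have "span ?B = carrier (Halpha n)"
  proof
    show "span ?B \<subseteq> carrier (Halpha n)"
      using B(1) by (rule span_is_subset2)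
    show "carrier (Halpha n) \<subseteq> span ?B"
    proof
      fix f assume f: "f \<in> carrier (Halpha n)"
      obtain r where r: "\<And>I. r I \<in> carrier ?R"
          "\<And>u. u \<in> Sym (n + 1) \<Longrightarrow> f u = (\<Sum>I\<in>A_set n. r I * c_class n I u)"
        using c_class_span[OF f] by metis
      \<comment> \<open>Coefficients in \<open>lincomb\<close> are attached to classes rather than
        indices, so the indexing is inverted.\<close>
      define a where "a v = r (inv_into (A_set n) (c_class n) v)" for v
      have a: "a \<in> ?B \<rightarrow> carrier ?R"
        using r(1) by (simp add: a_def)
      have "f = lincomb a ?B"
        using r(2) Halpha_carrierD(3)[OF f] inj_on_c_class
        by (auto simp: lincomb[OF a] a_def fun_eq_iff extensional_def restrict_def)
      then show "f \<in> span ?B"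
        using finite_span[OF B(2,1)] a by blast
    qed
  qed
  ultimately have "is_module_basis ?R (Halpha n) ?B"
    using mod B(1) by (simp add: is_module_basis_def)
  then show ?thesis
    using inj_on_c_class c_class_W_invariant by (auto simp: Setcompr_eq_image)
qed

end
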